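(* On a grid composed of equilateral triangles, the cell-centered finite volume discretization of Laplace's equation has local truncation error of order $h$. Precisely: let $\Psi$ be a solution of Laplace's equation $\Psi_{xx}+\Psi_{yy}=0$ on an open set $U\subset\mathbb{R}^2$, and let $p\in U$. For $h>0$, consider a grid of congruent equilateral triangles of side length $l=2h$ in which one triangle, $\Omega_1$, has circumcenter $p$. Then the local truncation error $e_\Delta$ of the scheme at $p$ (defined in the context) satisfies $$e_\Delta=\mathcal{O}(h)\qquad\text{as } h\to 0 .$$
   Context: The cell-centered finite volume scheme. Given a triangulation, one unknown is attached to the circumcenter of each triangle. Let $\Omega_1$ be a triangle (its area is also denoted $\Omega_1$) with circumcenter $p_1$, and let $p_2,p_3,p_4$ be the circumcenters of the three triangles that share an edge with $\Omega_1$. For $m=2,3,4$ let $\ell_m$ be the length of the edge shared by $\Omega_1$ and the triangle with circumcenter $p_m$, and let $d_m=|p_m-p_1|$. The integral of the Laplacian of a function $\psi$ over $\Omega_1$ is approximated by the discrete expression $$\int_{\Omega_1}\Delta\psi\,dx\,dy\;\approx\;L_1(\psi):=\sum_{m=2}^{4}\frac{\ell_m}{d_m}\bigl(\psi(p_m)-\psi(p_1)\bigr),$$ and the scheme for Laplace's equation is $L_1(\psi)=0$. The local truncation error at $p_1$ is obtained by inserting an exact solution $\Psi$ of Laplace's equation into the discrete expression and dividing by the area: $$e_\Delta=\frac{L_1(\Psi)}{\Omega_1}.$$ The point $p_1=p$ is held fixed as $h\to0$, and $h$ is half of the side length $l$ of the equilateral triangles. For $h$ small enough all four circumcenters lie in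 $U$, so $e_\Delta$ is defined. *)

theory Defs
  imports "HOL-Analysis.Analysis" "HOL-Library.Landau_Symbols"
begin

section \<open>Classical solutions of Laplace's equation in the plane\<close>

definition partial_deriv :: "2 \<Rightarrow> (real^2 \<Rightarrow> real) \<Rightarrow> real^2 \<Rightarrow> real" where
  "partial_deriv i f x = deriv (\<lambda>t. f (x + t *\<^sub>R axis i 1)) 0"

definition C1_on :: "(real^2) set \<Rightarrow> (real^2 \<Rightarrow> real) \<Rightarrow> bool" where
  "C1_on U f \<longleftrightarrow>
     (\<forall>i. (\<forall>x\<in>U. (\<lambda>t. f (x + t *\<^sub>R axis i 1)) differentiable (at 0)) \<and>
          continuous_on U (partial_deriv i f))"

definition C2_on :: "(real^2) set \<Rightarrow> (real^2 \<Rightarrow> real) \<Rightarrow> bool" where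
  "C2_on U f \<longleftrightarrow> C1_on U f \<and> (\<forall>i. C1_on U (partial_deriv i f))"

definition solves_laplace_on :: "(real^2) set \<Rightarrow> (real^2 \<Rightarrow> real) \<Rightarrow> bool" where
  "solves_laplace_on U \<psi> \<longleftrightarrow> C2_on U \<psi> \<and>
     (\<forall>x\<in>U. partial_deriv 1 (partial_deriv 1 \<psi>) x + partial_deriv 2 (partial_deriv 2 \<psi>) x = 0)"

section \<open>Triangulations and the cell-centered finite volume scheme\<close>

(* Triangles are closed point sets.  The library's triangulation predicate also
   requires finiteness, which would exclude grids of the whole plane. *)
definition plane_triangulation :: "(real^2) set set \<Rightarrow> bool" where
  "plane_triangulation \<G> \<longleftrightarrow>
     (\<forall>T\<in>\<G>. 2 simplex T) \<and> (\<forall>T\<in>\<G>. \<forall>T'\<in>\<G>. (T \<inter> T') face_of T)"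

definition circumcenter :: "(real^2) set \<Rightarrow> real^2" where
  "circumcenter T = (THE c. \<exists>r. \<forall>v. v extreme_point_of T \<longrightarrow> dist c v = r)"

definition neighbours :: "(real^2) set set \<Rightarrow> (real^2) set \<Rightarrow> (real^2) set set" where
  "neighbours \<G> T = {T'\<in>\<G>. (T \<inter> T') edge_of T \<and> (T \<inter> T') edge_of T'}"

(* The length of the shared edge is its diameter, the edge being a segment. *)
definition fv_laplacian ::
  "(real^2) set set \<Rightarrow> (real^2) set \<Rightarrow> (real^2 \<Rightarrow> real) \<Rightarrow> real" where
  "fv_laplacian \<G> T \<psi> =
     (\<Sum>T'\<in>neighbours \<G> T.
        diameter (T \<inter> T') / dist (circumcenter T') (circumcenter T)
          * (\<psi> (circumcenter T') - \<psi> (circumcenter T)))"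

definition truncation_error ::
  "(real^2) set set \<Rightarrow> (real^2) set \<Rightarrow> (real^2 \<Rightarrow> real) \<Rightarrow> real" where
  "truncation_error \<G> T \<psi> = fv_laplacian \<G> T \<psi> / measure lebesgue T"

section \<open>Equilateral grids\<close>

definition equilateral_triangle :: "real \<Rightarrow> (real^2) set \<Rightarrow> bool" where
  "equilateral_triangle l T \<longleftrightarrow> l > 0 \<and>
     (\<exists>a b c. T = convex hull {a, b, c} \<and> dist a b = l \<and> dist b c = l \<and> dist c a = l)"

definition equilateral_grid :: "real \<Rightarrow> (real^2) set set \<Rightarrow> bool" where
  "equilateral_grid l \<G> \<longleftrightarrow> plane_triangulation \<G> \<and> (\<forall>T\<in>\<G>. equilateral_triangle l T)"

end

(* The proof: near p the solution is the real part of a holomorphic F, because Psi_x - i Psi_y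
   satisfies the Cauchy-Riemann equations.  Reflecting an equilateral triangle in its edges sends
   its circumcenter p to the points 2p - v, v ranging over the vertices.  As complex numbers the
   three displacements p - v have equal modulus and sum zero, so their squares also sum to zero;
   hence the first and second order terms of the Taylor expansion of F cancel.  The remainder is
   O(h^3), and the area of the triangle is sqrt 3 h^2.  Holomorphy is what makes the remainder
   O(h^3): the C^2 regularity in the hypothesis alone would only give o(h^2). *)
theory Submission
  imports Defs "HOL-Complex_Analysis.Complex_Analysis"
begin

(* Complex_Analysis leaves the power series coefficient notation on, which makes v $ i ambiguous. *)
unbundle no Formal_Power_Series.fps_syntax

section \<open>Continuously differentiable functions of two variables\<close>

text \<open>\<open>partial_deriv\<close> differentiates at parameter 0 from a varying base point.
  Moving the base point along the axis gives the derivative at every parameter, as the mean value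
  theorem requires.\<close>

lemma partial_line_derivative:
  assumes "C1_on U f" and "x + t *\<^sub>R axis i 1 \<in> U"
  shows "((\<lambda>s. f (x + s *\<^sub>R axis i 1)) has_real_derivative
           partial_deriv i f (x + t *\<^sub>R axis i 1)) (at t)"
proof -
  let ?y = "x + t *\<^sub>R axis i 1"
  have "(\<lambda>s. f (?y + s *\<^sub>R axis i 1)) differentiable (at 0)"
    using assms unfolding C1_on_def by blast
  then have "((\<lambda>s. f (?y + s *\<^sub>R axis i 1)) has_real_derivative partial_deriv i f ?y) (at 0)"
    unfolding partial_deriv_def
    by (metis DERIV_imp_deriv real_differentiable_def)
  then have "((\<lambda>s. f (x + s *\<^sub>R axis i 1)) has_real_derivative partial_deriv i f ?y) (at (0 + t))"
    by (subst DERIV_shift) (simp add: scaleR_add_left add_ac)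
  then show ?thesis by simp
qed

lemma partial_mvt_pos:
  assumes "C1_on U f" and "0 < t" and "\<And>s. 0 \<le> s \<Longrightarrow> s \<le> t \<Longrightarrow> x + s *\<^sub>R axis i 1 \<in> U"
  obtains s where "0 < s" "s < t"
    "f (x + t *\<^sub>R axis i 1) - f x = t * partial_deriv i f (x + s *\<^sub>R axis i 1)"
  using MVT2[OF assms(2), of "\<lambda>s. f (x + s *\<^sub>R axis i 1)"
      "\<lambda>s. partial_deriv i f (x + s *\<^sub>R axis i 1)"]
    partial_line_derivative[OF assms(1)] assms(3) by auto

lemma partial_mvt:
  assumes "C1_on U f" and "\<And>s. \<bar>s\<bar> \<le> \<bar>t\<bar> \<Longrightarrow> x + s *\<^sub>R axis i 1 \<in> U"
  obtains s where "\<bar>s\<bar> \<le> \<bar>t\<bar>"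
    "f (x + t *\<^sub>R axis i 1) - f x = t * partial_deriv i f (x + s *\<^sub>R axis i 1)"
proof (cases "t < 0")
  case False
  show ?thesis
  proof (cases "t = 0")
    case True
    then show ?thesis using that[of 0] by simp
  next
    case False
    with \<open>\<not> t < 0\<close> have "0 < t" by simp
    then obtain s where "0 < s" "s < t"
      "f (x + t *\<^sub>R axis i 1) - f x = t * partial_deriv i f (x + s *\<^sub>R axis i 1)"
      using partial_mvt_pos[OF assms(1), of t x i] assms(2) by (metis abs_of_nonneg abs_of_pos)
    then show ?thesis using that[of s] by simp
  qed
next
  case True
  \<comment> \<open>For negative \<open>t\<close> the segment is traversed from its other endpoint,
    with the positive step \<open>-t\<close>.\<close>
  define y where "y = x + t *\<^sub>R axis i 1"
  have "y + s *\<^sub>R axis i 1 \<in> U" if "0 \<le> s" "s \<le> -t" for s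
    using assms(2)[of "t + s"] that True by (simp add: y_def scaleR_add_left add_ac)
  then obtain s where s: "0 < s" "s < - t"
      "f (y + (-t) *\<^sub>R axis i 1) - f y = (-t) * partial_deriv i f (y + s *\<^sub>R axis i 1)"
    using partial_mvt_pos[OF assms(1), of "-t" y i] True by auto
  then show ?thesis using that[of "t + s"] by (simp add: y_def scaleR_add_left add_ac)
qed

text \<open>Go from \<open>x\<close> to \<open>y\<close> by one step along each axis, apply the mean
  value theorem to each step, and use continuity of both partial derivatives at \<open>x\<close>;
  each step contributes half of the error \<open>e\<close>.\<close>

lemma C1_has_derivative:
  assumes "open U" and C1: "C1_on U f" and "x \<in> U"
  shows "(f has_derivative (\<lambda>v. v $ 1 * partial_deriv 1 f x + v $ 2 * partial_deriv 2 f x)) (at x)"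
  unfolding has_derivative_at_alt
proof (intro conjI allI impI)
  show "bounded_linear (\<lambda>v. v $ 1 * partial_deriv 1 f x + v $ 2 * partial_deriv 2 f x)"
    by (intro bounded_linear_add bounded_linear_mult_const bounded_linear_vec_nth)
next
  fix e :: real assume "e > 0"
  have cont: "\<exists>d>0. \<forall>y. dist y x < d \<longrightarrow> y \<in> U \<and> \<bar>partial_deriv i f y - partial_deriv i f x\<bar> < e/2" for i
  proof -
    have "isCont (partial_deriv i f) x"
      using C1 assms continuous_on_eq_continuous_at unfolding C1_on_def by blast
    then have "eventually (\<lambda>y. \<bar>partial_deriv i f y - partial_deriv i f x\<bar> < e/2) (nhds x)"
      using \<open>e > 0\<close> tendstoD[of "partial_deriv i f" _ "nhds x" "e/2"]
      by (simp add: isCont_def tendsto_at_iff_tendsto_nhds dist_real_def)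
    moreover have "eventually (\<lambda>y. y \<in> U) (nhds x)"
      using assms eventually_nhds by blast
    ultimately have "eventually (\<lambda>y. y \<in> U \<and> \<bar>partial_deriv i f y - partial_deriv i f x\<bar> < e/2) (nhds x)"
      by eventually_elim simp
    then show ?thesis by (simp add: eventually_nhds_metric)
  qed
  obtain d1 d2 where d: "d1 > 0" "d2 > 0"
    and d1: "\<And>y. dist y x < d1 \<Longrightarrow> y \<in> U \<and> \<bar>partial_deriv 1 f y - partial_deriv 1 f x\<bar> < e/2"
    and d2: "\<And>y. dist y x < d2 \<Longrightarrow> y \<in> U \<and> \<bar>partial_deriv 2 f y - partial_deriv 2 f x\<bar> < e/2"
    using cont by metis
  show "\<exists>d>0. \<forall>y. norm (y - x) < d \<longrightarrow>
    norm (f y - f x - ((y - x) $ 1 * partial_deriv 1 f x + (y - x) $ 2 * partial_deriv 2 f x))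
      \<le> e * norm (y - x)"
  proof (intro exI[of _ "min d1 d2"] conjI allI impI)
    show "0 < min d1 d2" using d by simp
    fix y assume y: "norm (y - x) < min d1 d2"
    define v where "v = y - x"
    define x' where "x' = x + (v $ 1) *\<^sub>R axis 1 1"
    have y_eq: "y = x' + (v $ 2) *\<^sub>R axis 2 1"
      by (simp add: x'_def v_def vec_eq_iff forall_2 axis_def)
    \<comment> \<open>Every point on the two axis-parallel steps is at least as close to
      \<open>x\<close> as \<open>y\<close> is, so both mean value points stay where the estimates
      hold.\<close>
    have le: "norm (s *\<^sub>R axis 1 1 + t *\<^sub>R axis 2 1 :: real^2) \<le> norm v"
      if "\<bar>s\<bar> \<le> \<bar>v $ 1\<bar>" "\<bar>t\<bar> \<le> \<bar>v $ 2\<bar>" for s t :: real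
      using that by (intro norm_le_componentwise_cart) (simp add: forall_2 axis_def)
    have near1: "dist (x + s *\<^sub>R axis 1 1) x < min d1 d2" if "\<bar>s\<bar> \<le> \<bar>v $ 1\<bar>" for s
      using le[of s 0] that y by (simp add: dist_norm v_def)
    have near2: "dist (x' + t *\<^sub>R axis 2 1) x < min d1 d2" if "\<bar>t\<bar> \<le> \<bar>v $ 2\<bar>" for t
      using le[of "v $ 1" t] that y by (simp add: dist_norm v_def x'_def add_ac)
    obtain s where s: "\<bar>s\<bar> \<le> \<bar>v $ 1\<bar>"
      "f x' - f x = v $ 1 * partial_deriv 1 f (x + s *\<^sub>R axis 1 1)"
      using partial_mvt[OF C1, of "v $ 1" x 1] near1 d1 unfolding x'_def by (metis min_less_iff_conj)
    obtain t where t: "\<bar>t\<bar> \<le> \<bar>v $ 2\<bar>"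
      "f y - f x' = v $ 2 * partial_deriv 2 f (x' + t *\<^sub>R axis 2 1)"
      using partial_mvt[OF C1, of "v $ 2" x' 2] near2 d2 unfolding y_eq by (metis min_less_iff_conj)
    define a where "a = partial_deriv 1 f (x + s *\<^sub>R axis 1 1) - partial_deriv 1 f x"
    define b where "b = partial_deriv 2 f (x' + t *\<^sub>R axis 2 1) - partial_deriv 2 f x"
    have "\<bar>a\<bar> \<le> e/2" "\<bar>b\<bar> \<le> e/2"
      using d1[of "x + s *\<^sub>R axis 1 1"] d2[of "x' + t *\<^sub>R axis 2 1"] near1[OF s(1)] near2[OF t(1)]
      by (auto simp: a_def b_def)
    then have "\<bar>v $ 1 * a\<bar> \<le> norm v * (e/2)" "\<bar>v $ 2 * b\<bar> \<le> norm v * (e/2)"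
      unfolding abs_mult by (intro mult_mono component_le_norm_cart; simp)+
    moreover have "f y - f x - (v $ 1 * partial_deriv 1 f x + v $ 2 * partial_deriv 2 f x)
        = v $ 1 * a + v $ 2 * b"
      using s(2) t(2) by (simp add: a_def b_def algebra_simps)
    ultimately show "norm (f y - f x -
        ((y - x) $ 1 * partial_deriv 1 f x + (y - x) $ 2 * partial_deriv 2 f x)) \<le> e * norm (y - x)"
      unfolding v_def[symmetric] by (simp add: mult.commute[of e])
  qed
qed

section \<open>Symmetry of the second partial derivatives\<close>

lemma second_difference_mvt:
  assumes C2: "C2_on U f" and "0 < t"
    and U: "\<And>r s. 0 \<le> r \<Longrightarrow> r \<le> t \<Longrightarrow> 0 \<le> s \<Longrightarrow> s \<le> t \<Longrightarrow> x + r *\<^sub>R axis i 1 + s *\<^sub>R axis j 1 \<in> U"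
  obtains r s where "0 < r" "r < t" "0 < s" "s < t"
    "f (x + t *\<^sub>R axis i 1 + t *\<^sub>R axis j 1) - f (x + t *\<^sub>R axis i 1) - f (x + t *\<^sub>R axis j 1) + f x
       = t * t * partial_deriv j (partial_deriv i f) (x + r *\<^sub>R axis i 1 + s *\<^sub>R axis j 1)"
proof -
  have C1: "C1_on U f" "C1_on U (partial_deriv i f)"
    using C2 by (auto simp: C2_on_def)
  \<comment> \<open>\<open>g\<close> is the difference of \<open>f\<close> across a step in
    direction \<open>j\<close>; its own increment from 0 to \<open>t\<close> in direction
    \<open>i\<close> is the second difference. One mean value theorem per direction then
    suffices.\<close>
  define g where "g s = f (x + t *\<^sub>R axis j 1 + s *\<^sub>R axis i 1) - f (x + s *\<^sub>R axis i 1)" for s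
  have "\<exists>r. 0 < r \<and> r < t \<and> g t - g 0 = (t - 0) *
      (partial_deriv i f (x + t *\<^sub>R axis j 1 + r *\<^sub>R axis i 1) - partial_deriv i f (x + r *\<^sub>R axis i 1))"
    unfolding g_def
  proof (rule MVT2[OF \<open>0 < t\<close>], rule DERIV_diff)
    fix s assume s: "0 \<le> s" "s \<le> t"
    show "((\<lambda>s. f (x + t *\<^sub>R axis j 1 + s *\<^sub>R axis i 1)) has_real_derivative
        partial_deriv i f (x + t *\<^sub>R axis j 1 + s *\<^sub>R axis i 1)) (at s)"
      using U[of s t] s \<open>0 < t\<close> by (intro partial_line_derivative[OF C1(1)]) (simp add: add_ac)
    show "((\<lambda>s. f (x + s *\<^sub>R axis i 1)) has_real_derivative
        partial_deriv i f (x + s *\<^sub>R axis i 1)) (at s)"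
      using U[of s 0] s \<open>0 < t\<close> by (intro partial_line_derivative[OF C1(1)]) simp
  qed
  then obtain r where r: "0 < r" "r < t" "g t - g 0 = t *
      (partial_deriv i f (x + r *\<^sub>R axis i 1 + t *\<^sub>R axis j 1) - partial_deriv i f (x + r *\<^sub>R axis i 1))"
    by (auto simp: add_ac)
  obtain s where s: "0 < s" "s < t"
    "partial_deriv i f (x + r *\<^sub>R axis i 1 + t *\<^sub>R axis j 1) - partial_deriv i f (x + r *\<^sub>R axis i 1)
      = t * partial_deriv j (partial_deriv i f) (x + r *\<^sub>R axis i 1 + s *\<^sub>R axis j 1)"
    using partial_mvt_pos[OF C1(2) \<open>0 < t\<close>, of "x + r *\<^sub>R axis i 1" j] U[of r] r by auto
  show ?thesis
    using that[OF r(1,2) s(1,2)] r(3) s(3) by (simp add: g_def add_ac)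
qed

text \<open>The second difference does not depend on the order of the two directions, yet after
  division by \<open>t * t\<close> it is a value of either mixed derivative at a point near
  \<open>x\<close>. Continuity identifies the limits as \<open>t\<close> tends to 0.\<close>

lemma partial_deriv_commute:
  assumes "open U" and C2: "C2_on U f" and "x \<in> U"
  shows "partial_deriv i (partial_deriv j f) x = partial_deriv j (partial_deriv i f) x"
proof -
  obtain d where d: "d > 0" "ball x d \<subseteq> U"
    using assms open_contains_ball by blast
  \<comment> \<open>Two steps of length at most \<open>t\<close> reach no further than
    \<open>2 * t\<close>, hence the restriction \<open>t < d / 2\<close> below.\<close>
  have near: "dist x (x + r *\<^sub>R axis k 1 + s *\<^sub>R axis l 1) \<le> 2 * t"
    if "0 \<le> r" "r \<le> t" "0 \<le> s" "s \<le> t" for r s t :: real and k l :: 2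
  proof -
    have "norm (r *\<^sub>R axis k 1 + s *\<^sub>R axis l 1 :: real^2) \<le> r + s"
      using norm_triangle_ineq[of "r *\<^sub>R axis k 1 :: real^2" "s *\<^sub>R axis l 1"] that
      by (simp add: norm_axis_1)
    moreover have "dist x (x + r *\<^sub>R axis k 1 + s *\<^sub>R axis l 1) = norm (r *\<^sub>R axis k 1 + s *\<^sub>R axis l 1 :: real^2)"
      unfolding add.assoc dist_norm by (metis add_diff_cancel_left' norm_minus_commute)
    ultimately show ?thesis using that by simp
  qed
  have ex: "\<exists>y. dist x y \<le> 2 * t \<and>
     f (x + t *\<^sub>R axis k 1 + t *\<^sub>R axis l 1) - f (x + t *\<^sub>R axis k 1) - f (x + t *\<^sub>R axis l 1) + f x
       = t * t * partial_deriv l (partial_deriv k f) y" if t: "0 < t" "t < d / 2" for t k l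
  proof -
    have "x + r *\<^sub>R axis k 1 + s *\<^sub>R axis l 1 \<in> U" if "0 \<le> r" "r \<le> t" "0 \<le> s" "s \<le> t" for r s
      using near[of r t s k l] that t d by (intro subsetD[OF d(2)]) (simp add: mem_ball)
    then obtain r s where "0 < r" "r < t" "0 < s" "s < t"
      "f (x + t *\<^sub>R axis k 1 + t *\<^sub>R axis l 1) - f (x + t *\<^sub>R axis k 1) - f (x + t *\<^sub>R axis l 1) + f x
       = t * t * partial_deriv l (partial_deriv k f) (x + r *\<^sub>R axis k 1 + s *\<^sub>R axis l 1)"
      using second_difference_mvt[OF C2 \<open>0 < t\<close>, of x k l] by blast
    then show ?thesis using near[of r t s k l] by (intro exI conjI) auto
  qed
  \<comment> \<open>The summand 3 gives \<open>t n < d / 2\<close> already for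
    \<open>n = 0\<close>.\<close>
  define t where "t n = d / (3 + real n)" for n
  have t: "0 < t n" "t n < d / 2" for n
    using d by (simp_all add: t_def field_simps add_pos_nonneg)
  have lim: "t \<longlonglongrightarrow> 0" unfolding t_def by real_asymp
  define Y where "Y k l n = (SOME y. dist x y \<le> 2 * t n \<and>
     f (x + t n *\<^sub>R axis k 1 + t n *\<^sub>R axis l 1) - f (x + t n *\<^sub>R axis k 1) - f (x + t n *\<^sub>R axis l 1) + f x
       = t n * t n * partial_deriv l (partial_deriv k f) y)" for k l n
  have Y: "dist x (Y k l n) \<le> 2 * t n"
     "f (x + t n *\<^sub>R axis k 1 + t n *\<^sub>R axis l 1) - f (x + t n *\<^sub>R axis k 1) - f (x + t n *\<^sub>R axis l 1) + f x
       = t n * t n * partial_deriv l (partial_deriv k f) (Y k l n)" for k l n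
    using someI_ex[OF ex[OF t, of n k l]] unfolding Y_def by blast+
  have Ylim: "Y k l \<longlonglongrightarrow> x" for k l
  proof -
    have "(\<lambda>n. dist (Y k l n) x) \<longlonglongrightarrow> 0"
    proof (rule tendsto_sandwich[OF _ _ tendsto_const])
      show "(\<lambda>n. 2 * t n) \<longlonglongrightarrow> 0" by (rule tendsto_mult_right_zero[OF lim])
      show "eventually (\<lambda>n. dist (Y k l n) x \<le> 2 * t n) sequentially"
        using Y(1)[of k l] by (simp add: dist_commute)
    qed simp
    then show ?thesis by (subst tendsto_dist_iff)
  qed
  have plim: "(\<lambda>n. partial_deriv l (partial_deriv k f) (Y k l n)) \<longlonglongrightarrow> partial_deriv l (partial_deriv k f) x" for k l
  proof -
    have "isCont (partial_deriv l (partial_deriv k f)) x"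
      using C2 assms continuous_on_eq_continuous_at unfolding C2_on_def C1_on_def by blast
    then show ?thesis using Ylim isCont_tendsto_compose by blast
  qed
  have "t n * t n * partial_deriv j (partial_deriv i f) (Y i j n) = t n * t n * partial_deriv i (partial_deriv j f) (Y j i n)" for n
  proof -
    have "x + t n *\<^sub>R axis j 1 + t n *\<^sub>R axis i 1 = x + t n *\<^sub>R axis i 1 + t n *\<^sub>R axis j 1"
      by (simp only: add_ac)
    then show ?thesis using Y(2)[of n i j] Y(2)[of n j i] by (simp only:)
  qed
  then have "partial_deriv j (partial_deriv i f) (Y i j n) = partial_deriv i (partial_deriv j f) (Y j i n)" for n
    using t(1)[of n] by (metis less_irrefl mult_cancel_left no_zero_divisors)
  then show ?thesis
    using plim[of j i] plim[of i j] LIMSEQ_unique by simp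
qed

section \<open>Harmonic functions as real parts of holomorphic functions\<close>

definition to_complex :: "real^2 \<Rightarrow> complex" where
  "to_complex v = Complex (v $ 1) (v $ 2)"

definition of_complex :: "complex \<Rightarrow> real^2" where
  "of_complex z = vector [Re z, Im z]"

lemma of_complex_nth [simp]: "of_complex z $ 1 = Re z" "of_complex z $ 2 = Im z"
  by (simp_all add: of_complex_def)

lemma Re_to_complex [simp]: "Re (to_complex v) = v $ 1"
  and Im_to_complex [simp]: "Im (to_complex v) = v $ 2"
  by (simp_all add: to_complex_def)

lemma of_complex_to_complex [simp]: "of_complex (to_complex v) = v"
  by (simp add: vec_eq_iff forall_2)

lemma to_complex_of_complex [simp]: "to_complex (of_complex z) = z"
  by (simp add: complex_eq_iff)

lemma norm_to_complex [simp]: "norm (to_complex v) = norm v"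
  by (simp add: norm_vec_def L2_set_def sum_2 cmod_def)

lemma linear_to_complex: "linear to_complex"
  by (rule linearI) (simp_all add: complex_eq_iff)

lemma linear_of_complex: "linear of_complex"
  by (rule linearI) (simp_all add: vec_eq_iff forall_2)

lemma dist_to_complex [simp]: "dist (to_complex v) (to_complex w) = dist v w"
  by (metis dist_norm linear_diff linear_to_complex norm_to_complex)

section \<open>Cauchy-Riemann equations and the local holomorphic potential\<close>

text \<open>The shape of the two differentials encodes the Cauchy-Riemann equations: together they
  are multiplication by \<open>Complex a b\<close>.\<close>

lemma has_derivative_Re_Im_imp_field_derivative:
  fixes u v :: "complex \<Rightarrow> real"
  assumes "(u has_derivative (\<lambda>w. Re w * a - Im w * b)) (at z)"
    and "(v has_derivative (\<lambda>w. Re w * b + Im w * a)) (at z)"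
  shows "((\<lambda>z. Complex (u z) (v z)) has_field_derivative Complex a b) (at z)"
proof -
  have "((\<lambda>z. Complex (u z) (v z)) has_derivative
      (\<lambda>w. Complex (Re w * a - Im w * b) (Re w * b + Im w * a))) (at z)"
    unfolding Complex_eq by (intro derivative_intros assms)
  moreover have "(\<lambda>w. Complex (Re w * a - Im w * b) (Re w * b + Im w * a)) = (*) (Complex a b)"
    by (auto simp: complex_eq_iff algebra_simps)
  ultimately show ?thesis unfolding has_field_derivative_def by simp
qed

text \<open>The restriction to a ball supplies the convexity needed twice: for a primitive
  \<open>F\<close> of \<open>G\<close>, and for a function with zero derivative to be
  constant.\<close>

lemma laplace_solution_local_Re:
  assumes "open U" and "p \<in> U" and lap: "solves_laplace_on U \<psi>"
  obtains r F where "r > 0" "F holomorphic_on ball (to_complex p) r"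
    "\<And>v. v \<in> ball p r \<Longrightarrow> \<psi> v = Re (F (to_complex v))"
proof -
  define P where "P = partial_deriv 1 \<psi>"
  define Q where "Q = partial_deriv 2 \<psi>"
  have C2: "C2_on U \<psi>" and lap0: "\<And>x. x \<in> U \<Longrightarrow> partial_deriv 2 Q x = - partial_deriv 1 P x"
    using lap by (auto simp: solves_laplace_on_def P_def Q_def add_eq_0_iff)
  have C1: "C1_on U \<psi>" "C1_on U P" "C1_on U Q"
    using C2 by (auto simp: C2_on_def P_def Q_def)
  have mixed: "partial_deriv 2 P x = partial_deriv 1 Q x" if "x \<in> U" for x
    unfolding P_def Q_def by (rule partial_deriv_commute[OF assms(1) C2 that])
  obtain r where r: "r > 0" "ball p r \<subseteq> U"
    using assms open_contains_ball by blast
  let ?B = "ball (to_complex p) r"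
  have B: "of_complex z \<in> ball p r" if "z \<in> ?B" for z
    using that dist_to_complex[of p "of_complex z"] by simp
  \<comment> \<open>For \<open>G\<close>, one Cauchy-Riemann equation is Laplace's equation
    (\<open>lap0\<close>) and the other is the symmetry of the mixed derivatives
    (\<open>mixed\<close>).\<close>
  define G where "G z = Complex (P (of_complex z)) (- Q (of_complex z))" for z
  have der: "((\<lambda>z. f (of_complex z)) has_derivative
      (\<lambda>w. Re w * partial_deriv 1 f (of_complex z) + Im w * partial_deriv 2 f (of_complex z))) (at z)"
    if "C1_on U f" "z \<in> ?B" for f z
  proof -
    have "(of_complex has_derivative of_complex) (at z)"
      by (intro linear_imp_has_derivative linear_of_complex)
    from has_derivative_compose[OF this C1_has_derivative[OF assms(1) that(1)]] B[OF that(2)] r(2)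
    show ?thesis by auto
  qed
  have "(G has_field_derivative
      Complex (partial_deriv 1 P (of_complex z)) (- partial_deriv 1 Q (of_complex z))) (at z)"
    if z: "z \<in> ?B" for z
    unfolding G_def
  proof (rule has_derivative_Re_Im_imp_field_derivative)
    have U: "of_complex z \<in> U" using B[OF z] r by blast
    show "((\<lambda>z. P (of_complex z)) has_derivative (\<lambda>w. Re w * partial_deriv 1 P (of_complex z)
        - Im w * - partial_deriv 1 Q (of_complex z))) (at z)"
      using der[OF C1(2) z] mixed[OF U] by simp
    show "((\<lambda>z. - Q (of_complex z)) has_derivative (\<lambda>w. Re w * - partial_deriv 1 Q (of_complex z)
        + Im w * partial_deriv 1 P (of_complex z))) (at z)"
      using has_derivative_minus[OF der[OF C1(3) z]] lap0[OF U] by simp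
  qed
  then have "G holomorphic_on ?B"
    unfolding holomorphic_on_open[OF open_ball] by blast
  then obtain F where F: "\<And>z. z \<in> ?B \<Longrightarrow> (F has_field_derivative G z) (at z within ?B)"
    using holomorphic_convex_primitive'[OF convex_ball open_ball] by blast
  \<comment> \<open>The real part of \<open>F\<close> has gradient \<open>(Re G, - Im G)\<close>,
    which is the gradient of \<open>\<psi>\<close>; so \<open>H\<close> is a constant, and it is
    real and can be absorbed into \<open>F\<close>.\<close>
  define H where "H z = Re (F z) - \<psi> (of_complex z)" for z
  have "(H has_derivative (\<lambda>w. 0)) (at z within ?B)" if z: "z \<in> ?B" for z
  proof -
    have "(H has_derivative (\<lambda>w. Re (G z * w) -
        (Re w * partial_deriv 1 \<psi> (of_complex z) + Im w * partial_deriv 2 \<psi> (of_complex z)))) (at z within ?B)"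
      unfolding H_def using F[OF z]
      by (intro has_derivative_diff has_derivative_at_withinI[OF der[OF C1(1) z]]
          bounded_linear.has_derivative[OF bounded_linear_Re]) (simp add: has_field_derivative_def)
    then show ?thesis by (simp add: G_def P_def Q_def mult.commute)
  qed
  then obtain c where c: "\<And>z. z \<in> ?B \<Longrightarrow> H z = c"
    using has_derivative_zero_constant[OF convex_ball, of "to_complex p" r H] by blast
  show ?thesis
  proof (rule that[of r "\<lambda>z. F z - of_real c"])
    have "F holomorphic_on ?B"
      unfolding holomorphic_on_def field_differentiable_def using F by blast
    then show "(\<lambda>z. F z - of_real c) holomorphic_on ?B"
      by (intro holomorphic_intros)
    show "\<psi> v = Re (F (to_complex v) - of_real c)" if "v \<in> ball p r" for v
      using c[of "to_complex v"] that by (simp add: H_def)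
  qed (fact r)
qed

section \<open>Cubic Taylor remainder and the vanishing sum of squares\<close>

text \<open>The third derivative is continuous, hence bounded by some \<open>B\<close> on the
  compact ball of half the radius, and \<open>B\<close> controls the remainder.\<close>

lemma holomorphic_second_order_Taylor:
  assumes "F holomorphic_on ball z r" and "r > 0"
  obtains C \<delta> where "\<delta> > 0" "C \<ge> 0"
    "\<And>w. norm w \<le> \<delta> \<Longrightarrow>
      norm (F (z + w) - F z - deriv F z * w - (deriv ^^ 2) F z / 2 * w\<^sup>2) \<le> C * norm w ^ 3"
proof -
  let ?S = "cball z (r / 2)"
  have sub: "?S \<subseteq> ball z r" using assms(2) by (auto simp: mem_ball)
  have hol: "(deriv ^^ n) F holomorphic_on ball z r" for n
    by (intro holomorphic_higher_deriv assms open_ball)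
  have "compact ((deriv ^^ 3) F ` ?S)"
    using hol[of 3] sub by (intro compact_continuous_image compact_cball)
      (metis holomorphic_on_imp_continuous_on holomorphic_on_subset)
  then have "bounded ((deriv ^^ 3) F ` ?S)" by (rule compact_imp_bounded)
  then obtain B where B: "B > 0" "\<And>x. x \<in> ?S \<Longrightarrow> norm ((deriv ^^ 3) F x) \<le> B"
    unfolding bounded_pos by blast
  have der: "((deriv ^^ n) F has_field_derivative (deriv ^^ (Suc n)) F x) (at x within ?S)"
    if "x \<in> ?S" for n x
  proof -
    have "x \<in> ball z r" using that sub by blast
    then have "((deriv ^^ n) F has_field_derivative deriv ((deriv ^^ n) F) x) (at x)"
      by (rule holomorphic_derivI[OF hol open_ball])
    then show ?thesis unfolding funpow.simps comp_apply by (rule has_field_derivative_at_within)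
  qed
  have "norm (F (z + w) - F z - deriv F z * w - (deriv ^^ 2) F z / 2 * w\<^sup>2) \<le> B / 2 * norm w ^ 3"
    if w: "norm w \<le> r / 2" for w
  proof -
    \<comment> \<open>This form of the remainder has \<open>fact 2\<close> rather than
      \<open>fact 3\<close> in the denominator, whence the constant \<open>B / 2\<close>.\<close>
    have "norm ((deriv ^^ 0) F (z + w) - (\<Sum>i\<le>2. (deriv ^^ i) F z * (z + w - z) ^ i / fact i))
        \<le> B * norm (z + w - z) ^ Suc 2 / fact 2"
    proof (rule complex_Taylor[OF convex_cball[of z "r/2"], where f = "\<lambda>n. (deriv ^^ n) F"])
      show "norm ((deriv ^^ Suc 2) F x) \<le> B" if "x \<in> ?S" for x
        using B(2)[OF that] by (simp add: eval_nat_numeral)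
    qed (use w assms(2) der in \<open>auto simp: dist_norm\<close>)
    then show ?thesis
      by (simp add: numeral_2_eq_2 numeral_3_eq_3 algebra_simps)
  qed
  then show ?thesis using that[of "r/2" "B/2"] assms(2) B(1) by simp
qed

lemma equilateral_sum_squares_zero:
  fixes a b c :: complex
  assumes "a + b + c = 0" and "norm a = \<rho>" "norm b = \<rho>" "norm c = \<rho>"
  shows "a\<^sup>2 + b\<^sup>2 + c\<^sup>2 = 0"
proof (cases "\<rho> = 0")
  case False
  \<comment> \<open>Conjugating the vanishing sum, with \<open>cnj z = \<rho>\<^sup>2 / z\<close>, makes the second
    elementary symmetric function vanish as well.\<close>
  have cnj: "cnj z * z = of_real (\<rho>\<^sup>2)" if "norm z = \<rho>" for z
    using complex_norm_square[of z] that by (simp add: mult.commute)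
  have "of_real (\<rho>\<^sup>2) * (a * b + b * c + c * a) =
     (cnj c * c) * (a * b) + (cnj a * a) * (b * c) + (cnj b * b) * (c * a)"
    unfolding cnj[OF assms(2)] cnj[OF assms(3)] cnj[OF assms(4)] by (simp add: algebra_simps)
  also have "\<dots> = a * b * c * cnj (a + b + c)"
    by (simp add: algebra_simps)
  finally have "a * b + b * c + c * a = 0" using assms(1) False by simp
  moreover have "a\<^sup>2 + b\<^sup>2 + c\<^sup>2 = (a + b + c)\<^sup>2 - 2 * (a * b + b * c + c * a)"
    by (simp add: power2_eq_square algebra_simps)
  ultimately show ?thesis using assms(1) by simp
qed (use assms in auto)

section \<open>Equilateral triangles and their neighbours\<close>

text \<open>The vertices form an unordered set, so that the centroid and the sum over neighbours
  need no labelling.\<close>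

definition equilateral_vertices :: "real \<Rightarrow> (real^2) set \<Rightarrow> bool" where
  "equilateral_vertices l V \<longleftrightarrow> l > 0 \<and> card V = 3 \<and> (\<forall>x\<in>V. \<forall>y\<in>V. x \<noteq> y \<longrightarrow> dist x y = l)"

lemma equilateral_triangleE:
  assumes "equilateral_triangle l T"
  obtains V where "equilateral_vertices l V" "T = convex hull V"
proof -
  obtain a b c where abc: "l > 0" "T = convex hull {a, b, c}"
    "dist a b = l" "dist b c = l" "dist c a = l"
    using assms unfolding equilateral_triangle_def by blast
  then have "a \<noteq> b" "b \<noteq> c" "c \<noteq> a" by auto
  with abc have "equilateral_vertices l {a, b, c}"
    by (auto simp: equilateral_vertices_def dist_commute)
  with abc that show ?thesis by blast
qed

lemma equilateral_verticesE:
  assumes "equilateral_vertices l V"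
  obtains a b c where "V = {a, b, c}" "a \<noteq> b" "b \<noteq> c" "c \<noteq> a"
    "l > 0" "dist a b = l" "dist b c = l" "dist c a = l"
proof -
  obtain a b c where "V = {a, b, c}" "a \<noteq> b" "b \<noteq> c" "a \<noteq> c"
    using assms card_3_iff unfolding equilateral_vertices_def by metis
  with assms that show ?thesis unfolding equilateral_vertices_def by auto
qed

text \<open>Of three collinear points one lies between the others, which would force
  \<open>l = l + l\<close>.\<close>

lemma equilateral_vertices_affine_independent:
  assumes "equilateral_vertices l V"
  shows "\<not> affine_dependent V"
proof
  assume dep: "affine_dependent V"
  obtain a b c where V: "V = {a, b, c}" "l > 0" "dist a b = l" "dist b c = l" "dist c a = l"
    using assms by (rule equilateral_verticesE)
  with dep have "collinear {a, b, c}" by (simp add: affine_dependent_imp_collinear_3)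
  then show False
    using V by (auto simp: collinear_between_cases between dist_commute)
qed

section \<open>Centroid, circumcenter and the two possible apexes over an edge\<close>

lemma inner_real2: "x \<bullet> y = x $ 1 * y $ 1 + x $ 2 * y $ 2" for x y :: "real^2"
  by (simp add: inner_vec_def sum_2)

text \<open>The vectors orthogonal to \<open>n\<close> form a line. Parallelism is stated as a
  vanishing determinant, which also covers zero vectors; each component of \<open>n\<close>
  annihilates that determinant.\<close>

lemma orthogonal_in_plane_parallel:
  fixes n u w :: "real^2"
  assumes "n \<noteq> 0" "u \<bullet> n = 0" "w \<bullet> n = 0"
  shows "u $ 1 * w $ 2 = u $ 2 * w $ 1"
proof -
  have "n $ 1 * (u $ 1 * w $ 2 - u $ 2 * w $ 1) = 0" "n $ 2 * (u $ 1 * w $ 2 - u $ 2 * w $ 1) = 0"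
    using assms(2,3) unfolding inner_real2 by algebra+
  with assms(1) show ?thesis by (auto simp: vec_eq_iff forall_2)
qed

text \<open>Both points lie on the perpendicular bisector (hyperplane) of \<open>a\<close> and
  \<open>b\<close>.\<close>

lemma equidistant_inner:
  fixes a b x y :: "'a::real_inner"
  assumes "dist x a = dist x b" "dist y a = dist y b"
  shows "(x - y) \<bullet> (a - b) = 0"
proof -
  have "(x - a) \<bullet> (x - a) = (x - b) \<bullet> (x - b)" "(y - a) \<bullet> (y - a) = (y - b) \<bullet> (y - b)"
    using assms by (simp_all add: dist_norm dot_square_norm)
  then show ?thesis by (simp add: inner_diff_left inner_diff_right inner_commute)
qed

lemma equilateral_dist_centroid:
  assumes "equilateral_vertices l V" "v \<in> V"
  shows "dist ((1/3) *\<^sub>R \<Sum>V) v = l / sqrt 3"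
proof -
  obtain a b c where V: "V = {a, b, c}" "a \<noteq> b" "b \<noteq> c" "c \<noteq> a"
    "l > 0" "dist a b = l" "dist b c = l" "dist c a = l"
    using assms(1) by (rule equilateral_verticesE)
  have *: "dist ((1/3) *\<^sub>R (x + y + z)) z = l / sqrt 3"
    if "dist x y = l" "dist y z = l" "dist z x = l" for x y z :: "real^2"
  proof -
    have sq: "(x - y) \<bullet> (x - y) = l\<^sup>2" "(y - z) \<bullet> (y - z) = l\<^sup>2" "(z - x) \<bullet> (z - x) = l\<^sup>2"
      using that by (simp_all add: dist_norm dot_square_norm)
    \<comment> \<open>The centroid lies at two thirds of the median from \<open>z\<close>; this is
      Apollonius' formula for the median, scaled accordingly.\<close>
    have "(dist ((1/3) *\<^sub>R (x + y + z)) z)\<^sup>2 =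
        (2 * ((z - x) \<bullet> (z - x)) + 2 * ((y - z) \<bullet> (y - z)) - (x - y) \<bullet> (x - y)) / 9"
      by (simp add: dist_norm power2_norm_eq_inner inner_real2 field_simps)
    also have "\<dots> = (l / sqrt 3)\<^sup>2" unfolding sq by (simp add: power_divide)
    finally show ?thesis using V(5) by (simp add: power2_eq_iff_nonneg)
  qed
  have "\<Sum>V = a + b + c" using V by (simp add: add_ac)
  then show ?thesis
    using *[of a b c] *[of b c a] *[of c a b] assms(2) V by (auto simp: add_ac)
qed

text \<open>The definite description needs uniqueness: a second equidistant point would make two
  edges orthogonal to one nonzero vector, hence parallel to each other.\<close>

lemma circumcenter_equilateral:
  assumes "equilateral_vertices l V"
  shows "circumcenter (convex hull V) = (1/3) *\<^sub>R \<Sum>V"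
  unfolding circumcenter_def
proof (rule the_equality)
  let ?g = "(1/3) *\<^sub>R \<Sum>V"
  have ext: "v extreme_point_of (convex hull V) \<longleftrightarrow> v \<in> V" for v
    by (intro extreme_point_of_convex_hull_affine_independent
        equilateral_vertices_affine_independent[OF assms])
  show "\<exists>r. \<forall>v. v extreme_point_of (convex hull V) \<longrightarrow> dist ?g v = r"
    using equilateral_dist_centroid[OF assms] ext by blast
  fix x assume "\<exists>r. \<forall>v. v extreme_point_of (convex hull V) \<longrightarrow> dist x v = r"
  then obtain r where r: "\<And>v. v \<in> V \<Longrightarrow> dist x v = r" using ext by blast
  obtain a b c where V: "V = {a, b, c}" "a \<noteq> b" "b \<noteq> c" "c \<noteq> a"
    "l > 0" "dist a b = l" "dist b c = l" "dist c a = l"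
    using assms by (rule equilateral_verticesE)
  have eq: "(x - ?g) \<bullet> (u - v) = 0" if "u \<in> V" "v \<in> V" for u v
    by (rule equidistant_inner) (simp_all add: r that equilateral_dist_centroid[OF assms])
  show "x = ?g"
  proof (rule ccontr)
    assume "x \<noteq> ?g"
    then have par: "(a - b) $ 1 * (c - b) $ 2 = (a - b) $ 2 * (c - b) $ 1"
      using eq[of a b] eq[of c b] V(1)
      by (intro orthogonal_in_plane_parallel[of "x - ?g"]) (simp_all add: inner_commute)
    have sq: "(a - b) \<bullet> (a - b) = l\<^sup>2" "(c - b) \<bullet> (c - b) = l\<^sup>2"
      "((a - b) - (c - b)) \<bullet> ((a - b) - (c - b)) = l\<^sup>2"
      using V by (simp_all add: dist_norm dot_square_norm norm_minus_commute)
    then have "2 * ((a - b) \<bullet> (c - b)) = l\<^sup>2"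
      by (simp add: inner_diff_left inner_diff_right inner_commute)
    \<comment> \<open>Parallel edges give equality in Cauchy-Schwarz, whereas edges at 60 degrees
      have inner product half of \<open>l\<^sup>2\<close>.\<close>
    moreover have "((a - b) \<bullet> (c - b))\<^sup>2 = ((a - b) \<bullet> (a - b)) * ((c - b) \<bullet> (c - b))"
      using par unfolding inner_real2 by algebra
    ultimately have "3 * (l\<^sup>2)\<^sup>2 = 0" using sq(1,2) by algebra
    then show False using V(5) by simp
  qed
qed

text \<open>Both apexes lie on the perpendicular bisector of the edge, equally far from the midpoint
  \<open>?m\<close>; so they coincide or are exchanged by the point reflection in
  \<open>?m\<close>.\<close>

lemma equilateral_opposite_vertex:
  fixes a b c c' :: "real^2"
  assumes "a \<noteq> b" "dist c a = l" "dist c b = l" "dist c' a = l" "dist c' b = l"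
  shows "c' = c \<or> c' = a + b - c"
proof -
  let ?m = "(1/2) *\<^sub>R (a + b)"
  have m: "dist ?m a = dist ?m b"
    using dist_midpoint[of a b] by (simp add: midpoint_def inverse_eq_divide)
  have par: "(c - ?m) $ 1 * (c' - ?m) $ 2 = (c - ?m) $ 2 * (c' - ?m) $ 1"
    using assms m by (intro orthogonal_in_plane_parallel[of "a - b"] equidistant_inner) auto
  have sq: "(c - a) \<bullet> (c - a) = l\<^sup>2" "(c - b) \<bullet> (c - b) = l\<^sup>2" "(c' - a) \<bullet> (c' - a) = l\<^sup>2" "(c' - b) \<bullet> (c' - b) = l\<^sup>2"
    using assms by (simp_all add: dist_norm dot_square_norm)
  have eq: "(c' - ?m) \<bullet> (c' - ?m) = (c - ?m) \<bullet> (c - ?m)"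
  proof -
    have "(x - ?m) \<bullet> (x - ?m) = ((x - a) \<bullet> (x - a) + (x - b) \<bullet> (x - b)) / 2 - (a - b) \<bullet> (a - b) / 4" for x
      by (simp add: inner_real2 field_simps)
    then show ?thesis by (simp add: sq)
  qed
  \<comment> \<open>\<open>u\<close> and \<open>w\<close> are parallel and of equal length, so \<open>u = \<plusminus>w\<close>.\<close>
  define u w where "u = c' - ?m" and "w = c - ?m"
  \<comment> \<open>By Lagrange's identity the last square is the defect in Cauchy-Schwarz, so equal
    length and parallelism make this product vanish.\<close>
  have "((u - w) \<bullet> (u - w)) * ((u + w) \<bullet> (u + w)) =
      (u \<bullet> u - w \<bullet> w)\<^sup>2 + 4 * (w $ 1 * u $ 2 - w $ 2 * u $ 1)\<^sup>2"
    by (simp add: inner_real2 power2_eq_square algebra_simps)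
  also have "\<dots> = 0"
    using par eq by (simp add: u_def w_def)
  finally have "((u - w) \<bullet> (u - w)) * ((u + w) \<bullet> (u + w)) = 0" .
  then have "u = w \<or> u + w = 0" by simp
  moreover have "u + w = c' - (a + b - c)"
    by (simp add: u_def w_def algebra_simps flip: scaleR_add_left)
  moreover have "c' = c" if "u = w"
    using that by (simp add: u_def w_def)
  ultimately show ?thesis by (metis eq_iff_diff_eq_0)
qed

section \<open>Neighbouring triangles, area and the scheme on an equilateral grid\<close>

lemma diameter_closed_segment: "diameter (closed_segment a b) = dist a b"
  for a b :: "'a::euclidean_space"
proof (rule antisym)
  show "diameter (closed_segment a b) \<le> dist a b"
    using simplex_extremal_le_exists[of "{a, b}"] unfolding segment_convex_hull
    by (intro diameter_le) (fastforce simp: dist_norm norm_minus_commute)+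
  show "dist a b \<le> diameter (closed_segment a b)"
    by (simp add: diameter_bounded_bound bounded_closed_segment)
qed

text \<open>The common edge is spanned by the same two vertices in both triangles, so the
  neighbour's third vertex is the other apex over it. \<open>\<Sum>V - 2 *\<^sub>R v\<close> is that
  apex, the sum of the edge's endpoints minus \<open>v\<close>; comparing centroids yields the new
  circumcenter.\<close>

lemma equilateral_neighbour:
  assumes V: "equilateral_vertices l V" and V': "equilateral_vertices l V'"
    and edge: "convex hull V \<inter> convex hull V' edge_of convex hull V"
    and edge': "convex hull V \<inter> convex hull V' edge_of convex hull V'"
  obtains v where "v \<in> V" "V' = insert (\<Sum>V - 2 *\<^sub>R v) (V - {v})"
    "diameter (convex hull V \<inter> convex hull V') = l"
    "circumcenter (convex hull V') = 2 *\<^sub>R circumcenter (convex hull V) - v"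
proof -
  let ?E = "convex hull V \<inter> convex hull V'"
  have face: "\<exists>S. S \<subseteq> W \<and> card S = 2 \<and> ?E = convex hull S \<and> \<not> affine_dependent S"
    if W: "equilateral_vertices l W" and E: "?E edge_of convex hull W" for W
  proof -
    have ind: "\<not> affine_dependent W"
      using W by (rule equilateral_vertices_affine_independent)
    obtain S where S: "S \<subseteq> W" "?E = convex hull S"
      using E face_of_convex_hull_affine_independent[OF ind] unfolding edge_of_def by blast
    then have indS: "\<not> affine_dependent S" using ind affine_independent_subset by blast
    have "aff_dim S = 1" using E S(2) by (simp add: edge_of_def aff_dim_convex_hull)
    then have "card S = 2" using aff_dim_affine_independent[OF indS] by simp
    with S indS show ?thesis by blast
  qed
  obtain S where S: "S \<subseteq> V" "card S = 2" "?E = convex hull S" "\<not> affine_dependent S"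
    using face[OF V edge] by blast
  obtain S' where S': "S' \<subseteq> V'" "?E = convex hull S'" "\<not> affine_dependent S'"
    using face[OF V' edge'] by blast
  \<comment> \<open>An affinely independent set is recovered from its convex hull as the set of
    extreme points.\<close>
  have "S = S'"
    using S S' extreme_point_of_convex_hull_affine_independent by (metis subsetI subset_antisym)
  have third: "\<exists>v. v \<notin> S \<and> W = insert v S" if "equilateral_vertices l W" "S \<subseteq> W" for W
  proof -
    have "finite W" "card W = 3"
      using that(1) by (auto simp: equilateral_vertices_def card_ge_0_finite)
    then have "card (W - S) = 1" using that(2) S(2) by (simp add: card_Diff_subset finite_subset)
    then show ?thesis using that(2) card_1_singletonE by (metis Diff_iff Un_insert_right insertI1 sup_bot_right Diff_partition sup_commute)
  qed
  obtain v where v: "v \<notin> S" "V = insert v S" using third[OF V S(1)] by blast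
  obtain v' where v': "v' \<notin> S" "V' = insert v' S"
    using third[OF V'] S'(1) \<open>S = S'\<close> by blast
  obtain x y where xy: "S = {x, y}" "x \<noteq> y" using S(2) card_2_iff by metis
  have sum: "\<Sum>V = x + y + v" using v xy by (simp add: add_ac)
  have sum': "\<Sum>V' = x + y + v'" using v' xy by (simp add: add_ac)
  have "v' = v \<or> v' = x + y - v"
  proof (rule equilateral_opposite_vertex[OF xy(2)])
    show "dist v x = l" "dist v y = l" "dist v' x = l" "dist v' y = l"
      using V V' v v' xy unfolding equilateral_vertices_def by auto
  qed
  \<comment> \<open>Equal apexes would make the triangles equal, and their intersection would have
    dimension 2 instead of 1.\<close>
  moreover have "v' \<noteq> v"
  proof
    assume "v' = v"
    then have "V' = V" using v v' by simp
    then have "aff_dim V = 1" using edge by (simp add: edge_of_def aff_dim_convex_hull)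
    moreover have "aff_dim V = 2"
      using aff_dim_affine_independent[OF equilateral_vertices_affine_independent[OF V]] V
      by (simp add: equilateral_vertices_def)
    ultimately show False by simp
  qed
  ultimately have v'_eq: "v' = x + y - v" by blast
  show ?thesis
  proof (rule that[of v])
    show "v \<in> V" using v by simp
    show "V' = insert (\<Sum>V - 2 *\<^sub>R v) (V - {v})"
      using v v' v'_eq sum by (auto simp: scaleR_2)
    have "dist x y = l" using V v xy unfolding equilateral_vertices_def by auto
    then show "diameter ?E = l"
      unfolding S(3) xy(1) by (simp add: segment_convex_hull[symmetric] diameter_closed_segment)
    show "circumcenter (convex hull V') = 2 *\<^sub>R circumcenter (convex hull V) - v"
      unfolding circumcenter_equilateral[OF V] circumcenter_equilateral[OF V'] sum sum' v'_eq
      by (simp add: vec_eq_iff field_simps)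
  qed
qed

lemma measure_equilateral_triangle:
  assumes "equilateral_vertices l V"
  shows "measure lebesgue (convex hull V) = sqrt 3 / 4 * l\<^sup>2"
proof -
  obtain a b c where V: "V = {a, b, c}" "l > 0" "dist a b = l" "dist b c = l" "dist c a = l"
    using assms by (rule equilateral_verticesE)
  have "convex hull V \<in> sets borel"
    using V(1) by (intro borel_closed compact_imp_closed finite_imp_compact_convex_hull) simp
  then have "measure lebesgue (convex hull V) = measure lborel (convex hull V)"
    by (simp add: measure_completion)
  also have "\<dots> = sqrt ((l + l + l) / 2 * ((l + l + l) / 2 - l) * ((l + l + l) / 2 - l) * ((l + l + l) / 2 - l))"
    using heron[of a b c] V by (simp add: dist_commute)
  also have "(l + l + l) / 2 * ((l + l + l) / 2 - l) * ((l + l + l) / 2 - l) * ((l + l + l) / 2 - l) = 3 * (l\<^sup>2 / 4)\<^sup>2"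
    by (simp add: power2_eq_square)
  also have "sqrt \<dots> = sqrt 3 / 4 * l\<^sup>2"
    by (simp only: real_sqrt_mult real_sqrt_abs) simp
  finally show ?thesis .
qed

text \<open>Each neighbour lies opposite a vertex, and having three of them turns this into a
  bijection with \<open>V\<close>. All weights equal \<open>sqrt 3\<close>, since the circumcenters
  are one circumradius \<open>l / sqrt 3\<close> apart.\<close>

lemma fv_laplacian_equilateral:
  assumes grid: "equilateral_grid l \<G>" and T: "convex hull V \<in> \<G>" and V: "equilateral_vertices l V"
    and card: "card (neighbours \<G> (convex hull V)) = 3"
  defines "p \<equiv> circumcenter (convex hull V)"
  shows "fv_laplacian \<G> (convex hull V) \<psi> = sqrt 3 * (\<Sum>v\<in>V. \<psi> (2 *\<^sub>R p - v) - \<psi> p)"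
proof -
  let ?T = "convex hull V"
  define N where "N v = convex hull (insert (\<Sum>V - 2 *\<^sub>R v) (V - {v}))" for v
  have nb: "\<exists>v\<in>V. T' = N v \<and> diameter (?T \<inter> T') = l \<and> circumcenter T' = 2 *\<^sub>R p - v"
    if T': "T' \<in> neighbours \<G> ?T" for T'
  proof -
    obtain V' where V': "equilateral_vertices l V'" "T' = convex hull V'"
      using grid T' equilateral_triangleE unfolding equilateral_grid_def neighbours_def by blast
    with T' obtain v where "v \<in> V" "V' = insert (\<Sum>V - 2 *\<^sub>R v) (V - {v})"
      "diameter (?T \<inter> T') = l" "circumcenter T' = 2 *\<^sub>R p - v"
      using equilateral_neighbour[OF V V'(1)] unfolding neighbours_def p_def by blast
    with V'(2) show ?thesis unfolding N_def by blast
  qed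
  have fin: "finite V" "card V = 3"
    using V by (auto simp: equilateral_vertices_def card_ge_0_finite)
  have sub: "neighbours \<G> ?T \<subseteq> N ` V" using nb by blast
  \<comment> \<open>Counting: three neighbours among at most three candidates leave none out and
    make \<open>N\<close> injective.\<close>
  have "card (N ` V) \<le> 3" using card_image_le[OF fin(1), of N] fin(2) by simp
  then have eq: "neighbours \<G> ?T = N ` V"
    using sub card fin(1) by (intro card_seteq) auto
  then have inj: "inj_on N V" using card fin by (intro eq_card_imp_inj_on) auto
  have N: "diameter (?T \<inter> N v) = l" "circumcenter (N v) = 2 *\<^sub>R p - v" if "v \<in> V" for v
    using nb[of "N v"] eq inj that by (auto dest: inj_onD)
  have "l > 0" using V by (simp add: equilateral_vertices_def)
  have d: "l / dist (2 *\<^sub>R p - v) p = sqrt 3" if "v \<in> V" for v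
  proof -
    have "dist (2 *\<^sub>R p - v) p = dist p v"
      by (simp add: dist_norm scaleR_2)
    also have "\<dots> = l / sqrt 3"
      unfolding p_def circumcenter_equilateral[OF V] by (rule equilateral_dist_centroid[OF V that])
    finally show ?thesis using \<open>l > 0\<close> by simp
  qed
  have "fv_laplacian \<G> ?T \<psi> = (\<Sum>v\<in>V. l / dist (2 *\<^sub>R p - v) p * (\<psi> (2 *\<^sub>R p - v) - \<psi> p))"
    unfolding fv_laplacian_def eq sum.reindex[OF inj] p_def[symmetric]
    by (intro sum.cong) (simp_all add: N)
  also have "\<dots> = sqrt 3 * (\<Sum>v\<in>V. \<psi> (2 *\<^sub>R p - v) - \<psi> p)"
    unfolding sum_distrib_left by (intro sum.cong) (simp_all add: d)
  finally show ?thesis .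
qed

section \<open>The truncation error\<close>

text \<open>The orientation of the grid may change with \<open>h\<close>: the constants
  \<open>C\<close> and \<open>\<delta>\<close> depend on \<open>F\<close> near \<open>p\<close>
  only. Three neighbours mean that every edge of the triangle is shared.\<close>

theorem propositionA0p1:
  fixes U :: "(real^2) set" and \<Psi> :: "real^2 \<Rightarrow> real" and p :: "real^2"
    and \<G> :: "real \<Rightarrow> (real^2) set set" and \<Omega>\<^sub>1 :: "real \<Rightarrow> (real^2) set"
  assumes "open U" and "p \<in> U" and "solves_laplace_on U \<Psi>"
    and "\<And>h. h > 0 \<Longrightarrow> equilateral_grid (2 * h) (\<G> h)"
    and "\<And>h. h > 0 \<Longrightarrow> \<Omega>\<^sub>1 h \<in> \<G> h"
    and "\<And>h. h > 0 \<Longrightarrow> circumcenter (\<Omega>\<^sub>1 h) = p"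
    and "\<And>h. h > 0 \<Longrightarrow> card (neighbours (\<G> h) (\<Omega>\<^sub>1 h)) = 3"
  shows "(\<lambda>h. truncation_error (\<G> h) (\<Omega>\<^sub>1 h) \<Psi>) \<in> O[at_right 0](\<lambda>h. h)"
proof -
  let ?z = "to_complex p"
  obtain r F where r: "r > 0" "F holomorphic_on ball ?z r"
    and F: "\<And>v. v \<in> ball p r \<Longrightarrow> \<Psi> v = Re (F (to_complex v))"
    using laplace_solution_local_Re[OF assms(1-3)] by blast
  obtain C \<delta> where C: "\<delta> > 0" "C \<ge> 0" and taylor: "\<And>w. norm w \<le> \<delta> \<Longrightarrow>
      norm (F (?z + w) - F ?z - deriv F ?z * w - (deriv ^^ 2) F ?z / 2 * w\<^sup>2) \<le> C * norm w ^ 3"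
    using holomorphic_second_order_Taylor[OF r(2,1)] by blast
  \<comment> \<open>The factor 24 is 3 vertices times \<open>2 ^ 3\<close>, from displacements of
    length at most \<open>2 * h\<close>; the same length explains the thresholds
    \<open>r / 2\<close> and \<open>\<delta> / 2\<close>.\<close>
  have bound: "\<bar>truncation_error (\<G> h) (\<Omega>\<^sub>1 h) \<Psi>\<bar> \<le> 24 * C * h"
    if h: "0 < h" "h < r / 2" "h < \<delta> / 2" for h
  proof -
    obtain V where V: "equilateral_vertices (2 * h) V" and T: "\<Omega>\<^sub>1 h = convex hull V"
      using assms(4,5)[OF h(1)] equilateral_triangleE unfolding equilateral_grid_def by blast
    have p: "circumcenter (convex hull V) = p" using assms(6)[OF h(1)] T by simp
    have p_eq: "p = (1/3) *\<^sub>R \<Sum>V" using circumcenter_equilateral[OF V] p by simp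
    \<comment> \<open>The circumradius for side \<open>2 * h\<close>.\<close>
    define \<rho> where "\<rho> = 2 * h / sqrt 3"
    have \<rho>: "0 \<le> \<rho>" "\<rho> \<le> 2 * h" using h(1) by (auto simp: \<rho>_def field_simps)
    define w where "w v = to_complex (p - v)" for v
    have norm_w: "norm (w v) = \<rho>" if "v \<in> V" for v
      using equilateral_dist_centroid[OF V that] by (simp add: w_def \<rho>_def p_eq dist_norm)
    have fv: "fv_laplacian (\<G> h) (\<Omega>\<^sub>1 h) \<Psi> = sqrt 3 * (\<Sum>v\<in>V. \<Psi> (2 *\<^sub>R p - v) - \<Psi> p)"
      using fv_laplacian_equilateral[OF assms(4)[OF h(1)] _ V, of \<Psi>] assms(5,7)[OF h(1)] T p by simp
    have shift: "to_complex (2 *\<^sub>R p - v) = ?z + w v" for v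
      by (simp add: w_def complex_eq_iff)
    obtain a b c where abc: "V = {a, b, c}" "a \<noteq> b" "b \<noteq> c" "c \<noteq> a"
      using V by (rule equilateral_verticesE)
    have "w a + w b + w c = to_complex (3 *\<^sub>R p - \<Sum>V)"
      using abc by (simp add: w_def complex_eq_iff)
    then have "w a + w b + w c = 0"
      by (simp add: p_eq complex_eq_iff)
    then have w1: "(\<Sum>v\<in>V. w v) = 0" and w2: "(\<Sum>v\<in>V. (w v)\<^sup>2) = 0"
      using equilateral_sum_squares_zero[of "w a" "w b" "w c" \<rho>] norm_w abc by (simp_all add: add_ac)
    have "\<Psi> (2 *\<^sub>R p - v) - \<Psi> p = Re (F (?z + w v) - F ?z)" if "v \<in> V" for v
    proof -
      have "dist p (2 *\<^sub>R p - v) = norm (w v)"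
        unfolding w_def norm_to_complex by (simp add: dist_norm scaleR_2 norm_minus_commute)
      then have "2 *\<^sub>R p - v \<in> ball p r" using norm_w[OF that] \<rho> h by simp
      then show ?thesis using F[of "2 *\<^sub>R p - v"] F[of p] r(1) by (simp add: shift)
    qed
    then have "(\<Sum>v\<in>V. \<Psi> (2 *\<^sub>R p - v) - \<Psi> p) = Re (\<Sum>v\<in>V. F (?z + w v) - F ?z)"
      by simp
    \<comment> \<open>The inserted linear and quadratic terms sum to zero by \<open>w1\<close> and
      \<open>w2\<close>, leaving only Taylor remainders.\<close>
    also have "(\<Sum>v\<in>V. F (?z + w v) - F ?z) =
        (\<Sum>v\<in>V. F (?z + w v) - F ?z - deriv F ?z * w v - (deriv ^^ 2) F ?z / 2 * (w v)\<^sup>2)"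
      using w1 w2 by (simp add: sum_subtractf flip: sum_distrib_left sum_divide_distrib)
    finally have "\<bar>\<Sum>v\<in>V. \<Psi> (2 *\<^sub>R p - v) - \<Psi> p\<bar> \<le>
        norm (\<Sum>v\<in>V. F (?z + w v) - F ?z - deriv F ?z * w v - (deriv ^^ 2) F ?z / 2 * (w v)\<^sup>2)"
      by (simp only: abs_Re_le_cmod)
    also have "\<dots> \<le> (\<Sum>v\<in>V. C * norm (w v) ^ 3)"
      using norm_w \<rho> h by (intro sum_norm_le taylor) auto
    also have "\<dots> = 3 * (C * \<rho> ^ 3)"
      using norm_w V by (simp add: equilateral_vertices_def)
    also have "\<dots> \<le> 3 * (C * (2 * h) ^ 3)"
      using \<rho> C by (intro mult_left_mono power_mono) auto
    finally have main: "\<bar>\<Sum>v\<in>V. \<Psi> (2 *\<^sub>R p - v) - \<Psi> p\<bar> \<le> 24 * C * h ^ 3"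
      by (simp add: power_mult_distrib)
    \<comment> \<open>The weight \<open>sqrt 3\<close> cancels against the area
      \<open>sqrt 3 * h\<^sup>2\<close>.\<close>
    have "truncation_error (\<G> h) (\<Omega>\<^sub>1 h) \<Psi> = (\<Sum>v\<in>V. \<Psi> (2 *\<^sub>R p - v) - \<Psi> p) / h\<^sup>2"
      unfolding truncation_error_def fv unfolding T measure_equilateral_triangle[OF V]
      by (simp add: power_mult_distrib)
    also have "\<bar>\<dots>\<bar> \<le> 24 * C * h ^ 3 / h\<^sup>2"
      using main by (simp add: divide_right_mono)
    also have "\<dots> = 24 * C * h" using h by (simp add: eval_nat_numeral)
    finally show ?thesis .
  qed
  have "eventually (\<lambda>h. h < min (r / 2) (\<delta> / 2)) (at_right (0::real))"
    unfolding eventually_at_right_field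
    using r(1) C(1) by (intro exI[of _ "min (r/2) (\<delta>/2)"]) simp
  then have "eventually (\<lambda>h. norm (truncation_error (\<G> h) (\<Omega>\<^sub>1 h) \<Psi>) \<le> 24 * C * norm h) (at_right 0)"
    using eventually_at_right_less[of 0] by eventually_elim (use bound in simp)
  then show ?thesis by (rule bigoI)
qed

end
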